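(* Let $G=(V,E)$ be a graph, and let $(\mathbf{x},\mathbf{y},\mathbf{z},\mathbf{t})$ be a solution to the linear relaxation of the following system without the constraints (4.2): (4.1) $x_e=y_e+2z_e$ for all $e$; (4.3) $\sum_{e\in\delta(V_1,\dots,V_k)}t_e\ge k-1$ for every partition $V_1,\dots,V_k$ of $V$ into nonempty sets; (4.4) $t_e\le y_e+z_e\le 1$; (4.5) $0\le t_e\le 1$; (4.6) $0\le z_e\le 1$; and, relaxing integrality, $0\le y_e\le 1$ for all $e\in E$. If some constraint of the family (4.2) $\sum_{e\in F}(1-y_e)+\sum_{e\in\delta(v)\setminus F}y_e\ge 1$, for $v\in V$ and $F\subseteq\delta(v)$ with $|F|$ odd, is violated by $\mathbf{y}$, then such a violated constraint (i.e., a pair $(v,F)$) can be found in $O(|V|^2)$ time.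
   Context: $\delta(v)$ denotes the set of edges incident to $v$; $\delta(V_1,\dots,V_k)$ denotes the set of edges whose endpoints lie in different parts of the partition. *)

theory Defs
  imports Complex_Main "HOL-Library.Disjoint_Sets" "HOL-Library.Landau_Symbols"
begin

section \<open>Graphs and the linear system\<close>

text \<open>An edge is the two-element set of its endpoints, so there are no loops and no parallel
  edges.\<close>

definition simple_graph :: "'v set \<Rightarrow> 'v set set \<Rightarrow> bool" where
  "simple_graph V E \<longleftrightarrow> finite V \<and> (\<forall>e\<in>E. e \<subseteq> V \<and> card e = 2)"

definition incident :: "'v set set \<Rightarrow> 'v \<Rightarrow> 'v set set" where
  "incident E v = {e \<in> E. v \<in> e}"

definition multicut :: "'v set set \<Rightarrow> 'v set set \<Rightarrow> 'v set set" where
  "multicut E P = {e \<in> E. \<exists>A\<in>P. \<exists>B\<in>P. A \<noteq> B \<and> e \<inter> A \<noteq> {} \<and> e \<inter> B \<noteq> {}}"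

text \<open>The linear relaxation without the odd-set constraints. The parts of a partition in the sense
  of \<^const>\<open>partition_on\<close> are nonempty.\<close>

definition relaxed_solution ::
  "'v set \<Rightarrow> 'v set set \<Rightarrow> ('v set \<Rightarrow> real) \<Rightarrow> ('v set \<Rightarrow> real) \<Rightarrow> ('v set \<Rightarrow> real) \<Rightarrow>
    ('v set \<Rightarrow> real) \<Rightarrow> bool" where
  "relaxed_solution V E x y z t \<longleftrightarrow>
     (\<forall>e\<in>E. x e = y e + 2 * z e) \<and>
     (\<forall>P. partition_on V P \<longrightarrow> (\<Sum>e\<in>multicut E P. t e) \<ge> real (card P) - 1) \<and>
     (\<forall>e\<in>E. t e \<le> y e + z e \<and> y e + z e \<le> 1) \<and>
     (\<forall>e\<in>E. 0 \<le> t e \<and> t e \<le> 1) \<and>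
     (\<forall>e\<in>E. 0 \<le> z e \<and> z e \<le> 1) \<and>
     (\<forall>e\<in>E. 0 \<le> y e \<and> y e \<le> 1)"

definition odd_set_constraint :: "'v set set \<Rightarrow> ('v set \<Rightarrow> real) \<Rightarrow> 'v \<Rightarrow> 'v set set \<Rightarrow> bool" where
  "odd_set_constraint E y v F \<longleftrightarrow>
     (\<Sum>e\<in>F. 1 - y e) + (\<Sum>e\<in>incident E v - F. y e) \<ge> 1"

definition violated_pair ::
  "'v set \<Rightarrow> 'v set set \<Rightarrow> ('v set \<Rightarrow> real) \<Rightarrow> 'v \<Rightarrow> 'v set set \<Rightarrow> bool" where
  "violated_pair V E y v F \<longleftrightarrow>
     v \<in> V \<and> F \<subseteq> incident E v \<and> odd (card F) \<and> \<not> odd_set_constraint E y v F"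


section \<open>A real random access machine\<close>

text \<open>Running time is the number of elementary operations of a program of a structured real RAM.
  The memory consists of scalar variables and arrays holding either natural numbers or exact real
  numbers. Only natural numbers may be used as indices, and there is no primitive
  operation converting one kind of data into the other (in particular no rounding). Every node of an expression and every command costs one unit; a loop pays for each
  evaluation of its condition.\<close>

type_synonym vname = string

record state =
  nvar :: "vname \<Rightarrow> nat"
  rvar :: "vname \<Rightarrow> real"
  narr :: "vname \<Rightarrow> nat \<Rightarrow> nat"
  rarr :: "vname \<Rightarrow> nat \<Rightarrow> real"

datatype nexp =
    NConst nat
  | NVar vname
  | NRead vname nexp
  | NAdd nexp nexp
  | NSub nexp nexp

datatype rexp =
    RConst rat
  | RVar vname
  | RRead vname nexp
  | RAdd rexp rexp
  | RSub rexp rexp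
  | RMul rexp rexp
  | RDiv rexp rexp

datatype bexp =
    NLess nexp nexp
  | RLess rexp rexp
  | BNot bexp
  | BAnd bexp bexp

datatype com =
    Skip
  | NAssign vname nexp
  | RAssign vname rexp
  | NWrite vname nexp nexp
  | RWrite vname nexp rexp
  | Seq com com
  | If bexp com com
  | While bexp com

text \<open>Subtraction of natural numbers is truncated, and division by zero yields zero.\<close>

fun nval :: "nexp \<Rightarrow> state \<Rightarrow> nat" where
  "nval (NConst k) s = k"
| "nval (NVar a) s = nvar s a"
| "nval (NRead a i) s = narr s a (nval i s)"
| "nval (NAdd i j) s = nval i s + nval j s"
| "nval (NSub i j) s = nval i s - nval j s"

fun rval :: "rexp \<Rightarrow> state \<Rightarrow> real" where
  "rval (RConst q) s = of_rat q"
| "rval (RVar a) s = rvar s a"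
| "rval (RRead a i) s = rarr s a (nval i s)"
| "rval (RAdd p q) s = rval p s + rval q s"
| "rval (RSub p q) s = rval p s - rval q s"
| "rval (RMul p q) s = rval p s * rval q s"
| "rval (RDiv p q) s = rval p s / rval q s"

fun bval :: "bexp \<Rightarrow> state \<Rightarrow> bool" where
  "bval (NLess i j) s \<longleftrightarrow> nval i s < nval j s"
| "bval (RLess p q) s \<longleftrightarrow> rval p s < rval q s"
| "bval (BNot b) s \<longleftrightarrow> \<not> bval b s"
| "bval (BAnd b c) s \<longleftrightarrow> bval b s \<and> bval c s"

fun ncost :: "nexp \<Rightarrow> nat" where
  "ncost (NConst k) = 1"
| "ncost (NVar a) = 1"
| "ncost (NRead a i) = 1 + ncost i"
| "ncost (NAdd i j) = 1 + ncost i + ncost j"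
| "ncost (NSub i j) = 1 + ncost i + ncost j"

fun rcost :: "rexp \<Rightarrow> nat" where
  "rcost (RConst q) = 1"
| "rcost (RVar a) = 1"
| "rcost (RRead a i) = 1 + ncost i"
| "rcost (RAdd p q) = 1 + rcost p + rcost q"
| "rcost (RSub p q) = 1 + rcost p + rcost q"
| "rcost (RMul p q) = 1 + rcost p + rcost q"
| "rcost (RDiv p q) = 1 + rcost p + rcost q"

fun bcost :: "bexp \<Rightarrow> nat" where
  "bcost (NLess i j) = 1 + ncost i + ncost j"
| "bcost (RLess p q) = 1 + rcost p + rcost q"
| "bcost (BNot b) = 1 + bcost b"
| "bcost (BAnd b c) = 1 + bcost b + bcost c"

text \<open>\<open>exec c s k s'\<close>: started in \<open>s\<close>, the command \<open>c\<close> terminates in \<open>s'\<close> after exactly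
  \<open>k\<close> units of time.\<close>

inductive exec :: "com \<Rightarrow> state \<Rightarrow> nat \<Rightarrow> state \<Rightarrow> bool" where
  Skip: "exec Skip s 1 s"
| NAssign: "exec (NAssign a i) s (1 + ncost i) (s\<lparr>nvar := (nvar s)(a := nval i s)\<rparr>)"
| RAssign: "exec (RAssign a p) s (1 + rcost p) (s\<lparr>rvar := (rvar s)(a := rval p s)\<rparr>)"
| NWrite: "exec (NWrite a i j) s (1 + ncost i + ncost j)
    (s\<lparr>narr := (narr s)(a := (narr s a)(nval i s := nval j s))\<rparr>)"
| RWrite: "exec (RWrite a i p) s (1 + ncost i + rcost p)
    (s\<lparr>rarr := (rarr s)(a := (rarr s a)(nval i s := rval p s))\<rparr>)"
| Seq: "exec c s k s' \<Longrightarrow> exec d s' l s'' \<Longrightarrow> exec (Seq c d) s (1 + k + l) s''"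
| IfTrue: "bval b s \<Longrightarrow> exec c s k s' \<Longrightarrow> exec (If b c d) s (1 + bcost b + k) s'"
| IfFalse: "\<not> bval b s \<Longrightarrow> exec d s k s' \<Longrightarrow> exec (If b c d) s (1 + bcost b + k) s'"
| WhileFalse: "\<not> bval b s \<Longrightarrow> exec (While b c) s (1 + bcost b) s"
| WhileTrue: "bval b s \<Longrightarrow> exec c s k s' \<Longrightarrow> exec (While b c) s' l s'' \<Longrightarrow>
    exec (While b c) s (1 + bcost b + k + l) s''"

inductive_cases SkipE: "exec Skip s k s'"
inductive_cases NAssignE: "exec (NAssign a i) s k s'"
inductive_cases RAssignE: "exec (RAssign a p) s k s'"
inductive_cases NWriteE: "exec (NWrite a i j) s k s'"
inductive_cases RWriteE: "exec (RWrite a i p) s k s'"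
inductive_cases SeqE: "exec (Seq c d) s k s'"
inductive_cases IfE: "exec (If b c d) s k s'"
inductive_cases WhileE: "exec (While b c) s k s'"

lemma exec_deterministic: "exec c s k s' \<Longrightarrow> exec c s l s'' \<Longrightarrow> k = l \<and> s' = s''"
proof (induction arbitrary: l s'' rule: exec.induct)
  case (Skip s)
  from Skip.prems show ?case by (rule SkipE) simp
next
  case (NAssign a i s)
  from NAssign.prems show ?case by (rule NAssignE) simp
next
  case (RAssign a p s)
  from RAssign.prems show ?case by (rule RAssignE) simp
next
  case (NWrite a i j s)
  from NWrite.prems show ?case by (rule NWriteE) simp
next
  case (RWrite a i p s)
  from RWrite.prems show ?case by (rule RWriteE) simp
next
  case (Seq c s k s' d l' s1)
  from Seq.prems obtain k2 s2 l2 where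
    "l = 1 + k2 + l2" "exec c s k2 s2" "exec d s2 l2 s''"
    by (rule SeqE) simp
  then show ?case using Seq.IH by metis
next
  case (IfTrue b s c k s' d)
  from IfTrue.prems IfTrue.hyps obtain k2 where "l = 1 + bcost b + k2" "exec c s k2 s''"
    by (auto elim: IfE)
  then show ?case using IfTrue.IH by metis
next
  case (IfFalse b s d k s' c)
  from IfFalse.prems IfFalse.hyps obtain k2 where "l = 1 + bcost b + k2" "exec d s k2 s''"
    by (auto elim: IfE)
  then show ?case using IfFalse.IH by metis
next
  case (WhileFalse b s c)
  from WhileFalse.prems show ?case by (rule WhileE) (simp_all add: WhileFalse.hyps)
next
  case (WhileTrue b s c k s' l' s1)
  from WhileTrue.prems obtain k2 s2 l2 where
    "l = 1 + bcost b + k2 + l2" "exec c s k2 s2" "exec (While b c) s2 l2 s''"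
    by (rule WhileE) (simp_all add: WhileTrue.hyps(1))
  then show ?case using WhileTrue.IH by metis
qed


section \<open>Input and output of the separation routine\<close>

text \<open>The graph is given as a list of edges: the vertices and the edges are numbered (by their
  positions in \<open>vs\<close> and \<open>es\<close>), and the arrays \<open>a\<close> and \<open>b\<close> contain the numbers of the two
  endpoints of every edge. All memory not mentioned here may have arbitrary initial contents.\<close>

definition encodes_input ::
  "'v set \<Rightarrow> 'v set set \<Rightarrow> ('v set \<Rightarrow> real) \<Rightarrow> ('v set \<Rightarrow> real) \<Rightarrow> ('v set \<Rightarrow> real) \<Rightarrow>
    ('v set \<Rightarrow> real) \<Rightarrow> 'v list \<Rightarrow> 'v set list \<Rightarrow> state \<Rightarrow> bool" where
  "encodes_input V E x y z t vs es s \<longleftrightarrow>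
     distinct vs \<and> set vs = V \<and> distinct es \<and> set es = E \<and>
     nvar s ''n'' = length vs \<and> nvar s ''m'' = length es \<and>
     (\<forall>j<length es.
        narr s ''a'' j < length vs \<and> narr s ''b'' j < length vs \<and>
        es ! j = {vs ! narr s ''a'' j, vs ! narr s ''b'' j} \<and>
        rarr s ''x'' j = x (es ! j) \<and> rarr s ''y'' j = y (es ! j) \<and>
        rarr s ''z'' j = z (es ! j) \<and> rarr s ''t'' j = t (es ! j))"

text \<open>The output is the number \<open>v\<close> of a vertex together with the list of the numbers of the
  elements of an edge set, stored in the first \<open>k\<close> cells of the array \<open>F\<close>.\<close>

definition encodes_output ::
  "'v list \<Rightarrow> 'v set list \<Rightarrow> state \<Rightarrow> 'v \<Rightarrow> 'v set set \<Rightarrow> bool" where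
  "encodes_output vs es s v F \<longleftrightarrow>
     nvar s ''v'' < length vs \<and> v = vs ! nvar s ''v'' \<and>
     (\<forall>i<nvar s ''k''. narr s ''F'' i < length es) \<and>
     F = {es ! narr s ''F'' i | i. i < nvar s ''k''}"

end

theory Submission
  imports Defs
begin

text \<open>For a fixed vertex, let \<open>\<mu> e = min (y e) (1 - y e)\<close>. The left-hand side of the constraint for
  \<open>F\<close> equals the sum of \<open>\<mu>\<close> over the incident edges plus the sum of \<open>1 - 2 * \<mu>\<close> over the symmetric
  difference of \<open>F\<close> and \<open>H = {e. y e > 1 / 2}\<close>. Hence the best odd set is \<open>H\<close> itself if \<open>|H|\<close> is
  odd, and otherwise \<open>H\<close> with an edge minimising \<open>1 - 2 * \<mu>\<close> toggled. One pass over the edge list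
  collects the sum, the parity and the minimiser for all vertices simultaneously, so the time is
  linear in \<open>|V| + |E|\<close>.\<close>

section \<open>Timed total correctness\<close>

text \<open>Total correctness with a time bound. As \<open>exec\<close> is deterministic, the
  terminating run is the only one. A bound instead of an exact time lets branches of unequal cost
  share it.\<close>

definition ends_within :: "com \<Rightarrow> state \<Rightarrow> nat \<Rightarrow> (state \<Rightarrow> bool) \<Rightarrow> bool" where
  "ends_within c s t Q \<longleftrightarrow> (\<exists>k s'. exec c s k s' \<and> k \<le> t \<and> Q s')"

lemma ends_within_mono: "ends_within c s t Q \<Longrightarrow> (\<And>s'. Q s' \<Longrightarrow> R s') \<Longrightarrow> ends_within c s t R"
  unfolding ends_within_def by blast

lemma ends_within_Seq:
  assumes "ends_within c s t1 Q" "\<And>s'. Q s' \<Longrightarrow> ends_within d s' t2 R"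
  shows "ends_within (Seq c d) s (1 + t1 + t2) R"
proof -
  from assms(1) obtain k s' where 1: "exec c s k s'" "k \<le> t1" "Q s'"
    unfolding ends_within_def by blast
  from assms(2)[OF 1(3)] obtain l s'' where 2: "exec d s' l s''" "l \<le> t2" "R s''"
    unfolding ends_within_def by blast
  from exec.Seq[OF 1(1) 2(1)] 1 2 show ?thesis
    unfolding ends_within_def by (intro exI[of _ "1 + k + l"] exI[of _ s'']) auto
qed

text \<open>The invariant is indexed by the number of completed iterations and \<open>N\<close> is
  their exact number, so the index is also the termination measure. The induction descends from
  \<open>N\<close>; the summand outside the product pays for the final failing test.\<close>

lemma ends_within_While:
  assumes step: "\<And>i s. i < N \<Longrightarrow> I i s \<Longrightarrow> bval b s \<and> ends_within c s t (I (Suc i))"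
    and exit: "\<And>s. I N s \<Longrightarrow> \<not> bval b s"
    and init: "I 0 s"
  shows "ends_within (While b c) s ((1 + bcost b + t) * N + (1 + bcost b)) (I N)"
proof -
  have "\<forall>s. I i s \<longrightarrow> ends_within (While b c) s ((1 + bcost b + t) * (N - i) + (1 + bcost b)) (I N)"
    if "i \<le> N" for i
    using that
  proof (induction i rule: inc_induct)
    case base
    then show ?case
      unfolding ends_within_def using exec.WhileFalse exit by fastforce
  next
    case (step i)
    show ?case
    proof (intro allI impI)
      fix s assume "I i s"
      with assms(1)[OF step(2)] obtain k s' where
        1: "bval b s" "exec c s k s'" "k \<le> t" "I (Suc i) s'"
        unfolding ends_within_def by blast
      with step.IH obtain l s'' where
        2: "exec (While b c) s' l s''" "l \<le> (1 + bcost b + t) * (N - Suc i) + (1 + bcost b)" "I N s''"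
        unfolding ends_within_def by blast
      have "N - i = Suc (N - Suc i)" using step(2) by simp
      then have "1 + bcost b + k + l \<le> (1 + bcost b + t) * (N - i) + (1 + bcost b)"
        using 1 2 by simp
      with exec.WhileTrue[OF 1(1,2) 2(1)] 2(3)
      show "ends_within (While b c) s ((1 + bcost b + t) * (N - i) + (1 + bcost b)) (I N)"
        unfolding ends_within_def by blast
    qed
  qed
  from this[of 0] init show ?thesis by simp
qed

section \<open>Straight-line commands and derived tests\<close>

fun loop_free :: "com \<Rightarrow> bool" where
  "loop_free (Seq c d) \<longleftrightarrow> loop_free c \<and> loop_free d"
| "loop_free (If b c d) \<longleftrightarrow> loop_free c \<and> loop_free d"
| "loop_free (While b c) \<longleftrightarrow> False"
| "loop_free _ \<longleftrightarrow> True"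

text \<open>Without loops the final state is a function of the initial one, so simplification can
  compute it from the program text. The values at \<open>While\<close>, here and in
  \<open>max_cost\<close>, are dummies excluded by \<open>loop_free\<close>.\<close>

fun run :: "com \<Rightarrow> state \<Rightarrow> state" where
  "run Skip s = s"
| "run (NAssign a i) s = s\<lparr>nvar := (nvar s)(a := nval i s)\<rparr>"
| "run (RAssign a p) s = s\<lparr>rvar := (rvar s)(a := rval p s)\<rparr>"
| "run (NWrite a i j) s = s\<lparr>narr := (narr s)(a := (narr s a)(nval i s := nval j s))\<rparr>"
| "run (RWrite a i p) s = s\<lparr>rarr := (rarr s)(a := (rarr s a)(nval i s := rval p s))\<rparr>"
| "run (Seq c d) s = run d (run c s)"
| "run (If b c d) s = (if bval b s then run c s else run d s)"
| "run (While b c) s = s"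

fun max_cost :: "com \<Rightarrow> nat" where
  "max_cost Skip = 1"
| "max_cost (NAssign a i) = 1 + ncost i"
| "max_cost (RAssign a p) = 1 + rcost p"
| "max_cost (NWrite a i j) = 1 + ncost i + ncost j"
| "max_cost (RWrite a i p) = 1 + ncost i + rcost p"
| "max_cost (Seq c d) = 1 + max_cost c + max_cost d"
| "max_cost (If b c d) = 1 + bcost b + max (max_cost c) (max_cost d)"
| "max_cost (While b c) = 0"

lemma ends_within_loop_free:
  assumes "loop_free c" "Q (run c s)"
  shows "ends_within c s (max_cost c) Q"
proof -
  have "\<exists>k\<le>max_cost c. exec c s k (run c s)"
    using assms(1)
  proof (induction c arbitrary: s)
    case (Seq c d)
    then obtain k l where "k \<le> max_cost c" "exec c s k (run c s)"
      "l \<le> max_cost d" "exec d (run c s) l (run d (run c s))"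
      by fastforce
    then show ?case
      by (intro exI[of _ "1 + k + l"]) (auto intro: exec.Seq[simplified])
  next
    case (If b c d)
    then obtain k l where "k \<le> max_cost c" "exec c s k (run c s)"
      "l \<le> max_cost d" "exec d s l (run d s)"
      by fastforce
    then show ?case
      by (intro exI[of _ "1 + bcost b + (if bval b s then k else l)"])
        (auto intro: exec.IfTrue[simplified] exec.IfFalse[simplified])
  qed (auto intro: exec.intros exec.intros[simplified])
  with assms(2) show ?thesis unfolding ends_within_def by blast
qed

definition bor :: "bexp \<Rightarrow> bexp \<Rightarrow> bexp" where
  "bor b c = BNot (BAnd (BNot b) (BNot c))"

definition bxor :: "bexp \<Rightarrow> bexp \<Rightarrow> bexp" where
  "bxor b c = bor (BAnd b (BNot c)) (BAnd (BNot b) c)"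

definition nat_eq :: "nexp \<Rightarrow> nexp \<Rightarrow> bexp" where
  "nat_eq i j = BAnd (BNot (NLess i j)) (BNot (NLess j i))"

lemma bval_derived [simp]:
  "bval (bor b c) s \<longleftrightarrow> bval b s \<or> bval c s"
  "bval (bxor b c) s \<longleftrightarrow> bval b s \<noteq> bval c s"
  "bval (nat_eq i j) s \<longleftrightarrow> nval i s = nval j s"
  by (auto simp: bor_def bxor_def nat_eq_def)


section \<open>Optimal odd sets\<close>

definition odd_lhs :: "('i \<Rightarrow> real) \<Rightarrow> 'i set \<Rightarrow> 'i set \<Rightarrow> real" where
  "odd_lhs Y I G = (\<Sum>l\<in>G. 1 - Y l) + (\<Sum>l\<in>I - G. Y l)"

definition mu :: "('i \<Rightarrow> real) \<Rightarrow> 'i \<Rightarrow> real" where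
  "mu Y l = min (Y l) (1 - Y l)"

definition heavy :: "('i \<Rightarrow> real) \<Rightarrow> 'i set \<Rightarrow> 'i set" where
  "heavy Y I = {l \<in> I. Y l > 1/2}"

text \<open>Each \<open>l\<close> contributes \<open>Y l\<close> or \<open>1 - Y l\<close>: the
  smaller of the two when \<open>G\<close> and \<open>heavy Y I\<close> agree at \<open>l\<close>,
  otherwise \<open>1 - 2 * mu Y l\<close> more than that. At a tie \<open>Y l = 1/2\<close> this
  excess is 0.\<close>

lemma odd_lhs_eq:
  assumes "finite I" "G \<subseteq> I"
  shows "odd_lhs Y I G = (\<Sum>l\<in>I. mu Y l) + (\<Sum>l\<in>sym_diff G (heavy Y I). 1 - 2 * mu Y l)"
proof -
  have sub: "sym_diff G (heavy Y I) \<subseteq> I"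
    using assms(2) by (auto simp: heavy_def)
  have "odd_lhs Y I G = (\<Sum>l\<in>G. if l \<in> G then 1 - Y l else Y l) +
      (\<Sum>l\<in>I - G. if l \<in> G then 1 - Y l else Y l)"
    unfolding odd_lhs_def by (intro arg_cong2[of _ _ _ _ "(+)"] sum.cong) auto
  also have "\<dots> = (\<Sum>l\<in>I. if l \<in> G then 1 - Y l else Y l)"
    using sum.subset_diff[OF assms(2,1), of "\<lambda>l. if l \<in> G then 1 - Y l else Y l"]
    by simp
  also have "\<dots> = (\<Sum>l\<in>I. mu Y l + (if l \<in> sym_diff G (heavy Y I) then 1 - 2 * mu Y l else 0))"
    by (intro sum.cong) (auto simp: heavy_def mu_def min_def)
  also have "\<dots> = (\<Sum>l\<in>I. mu Y l) + (\<Sum>l\<in>sym_diff G (heavy Y I). 1 - 2 * mu Y l)"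
    using sum.inter_restrict[OF assms(1), of "\<lambda>l. 1 - 2 * mu Y l" "sym_diff G (heavy Y I)"] sub
    by (simp add: sum.distrib inf.absorb2)
  finally show ?thesis .
qed

lemma mu_half: "1 - 2 * mu Y l \<ge> 0"
  by (auto simp: mu_def min_def)

text \<open>The initial value \<open>1\<close> of \<open>d\<close> acts as infinity, because the sum \<open>c\<close> is nonnegative.\<close>

definition summary ::
  "('i \<Rightarrow> real) \<Rightarrow> 'i set \<Rightarrow> real \<Rightarrow> real \<Rightarrow> real \<Rightarrow> 'i \<Rightarrow> bool" where
  "summary Y I c q d w \<longleftrightarrow>
     finite I \<and> c = (\<Sum>l\<in>I. mu Y l) \<and> q = of_bool (odd (card (heavy Y I))) \<and>
     (\<forall>l\<in>I. d \<le> 1 - 2 * mu Y l) \<and> (d = 1 \<or> w \<in> I \<and> d = 1 - 2 * mu Y w)"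

lemma summary_empty: "summary Y {} 0 0 1 w"
  by (simp add: summary_def heavy_def)

text \<open>One step of the pass. The parity is kept as a real number, so \<open>1 - q\<close> flips
  it. An element with \<open>1 - 2 * mu Y j\<close> at least 1 fails the strict comparison with the
  initial \<open>d\<close>, and \<open>w\<close> stays unset; the alternative \<open>d = 1\<close>
  in \<open>summary\<close> covers this.\<close>

lemma summary_insert:
  assumes "summary Y I c q d w" "j \<notin> I"
  shows "summary Y (insert j I) (c + mu Y j) (if Y j > 1/2 then 1 - q else q)
    (if 1 - 2 * mu Y j < d then 1 - 2 * mu Y j else d) (if 1 - 2 * mu Y j < d then j else w)"
proof -
  have "heavy Y (insert j I) = (if Y j > 1/2 then insert j (heavy Y I) else heavy Y I)"
    by (auto simp: heavy_def)
  moreover have "finite (heavy Y I)" "j \<notin> heavy Y I"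
    using assms by (auto simp: heavy_def summary_def)
  ultimately show ?thesis
    using assms unfolding summary_def by auto
qed

text \<open>In the branch \<open>q < 1/2\<close> the index \<open>w\<close> is meaningful, since \<open>d \<noteq> 1\<close> under the hypothesis.\<close>

lemma summary_sound:
  assumes "summary Y I c q d w" "c + (1 - q) * d < 1" "\<And>l. l \<in> I \<Longrightarrow> 0 \<le> Y l \<and> Y l \<le> 1"
  defines "G \<equiv> {l \<in> I. (Y l > 1/2) \<noteq> (q < 1/2 \<and> w = l)}"
  shows "odd (card G)" "odd_lhs Y I G < 1"
proof -
  have fin: "finite I" "finite (heavy Y I)"
    using assms(1) by (auto simp: summary_def heavy_def)
  have c: "c = (\<Sum>l\<in>I. mu Y l)" using assms(1) by (simp add: summary_def)
  have lhs: "odd_lhs Y I G = c + (\<Sum>l\<in>sym_diff G (heavy Y I). 1 - 2 * mu Y l)"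
    using odd_lhs_eq[of I G Y] fin(1) c by (auto simp: G_def)
  have "odd (card G) \<and> odd_lhs Y I G < 1"
  \<comment> \<open>If \<open>heavy Y I\<close> is odd, the factor \<open>1 - q\<close> removes
    \<open>d\<close>; if it is even, toggling the single element \<open>w\<close> repairs the parity
    at cost \<open>d\<close>.\<close>
  proof (cases "odd (card (heavy Y I))")
    case True
    then have q: "q = 1" using assms(1) by (simp add: summary_def)
    then have "G = heavy Y I" by (auto simp: G_def heavy_def)
    with True q assms(2) lhs show ?thesis by simp
  next
    case False
    then have q: "q = 0" using assms(1) by (simp add: summary_def)
    have "c \<ge> 0"
      unfolding c using assms(3) by (intro sum_nonneg) (simp add: mu_def)
    then have w: "w \<in> I" "d = 1 - 2 * mu Y w"
      using assms(1,2) q \<open>c \<ge> 0\<close> by (auto simp: summary_def)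
    have G: "G = (if w \<in> heavy Y I then heavy Y I - {w} else insert w (heavy Y I))"
      using w q by (auto simp: G_def heavy_def)
    then have "sym_diff G (heavy Y I) = {w}" by auto
    then have "odd_lhs Y I G < 1"
      using lhs assms(2) q w by simp
    moreover have "odd (card G)"
    proof (cases "w \<in> heavy Y I")
      case True
      then have "card (heavy Y I) = Suc (card G)"
        using G card.remove[OF fin(2) True] by simp
      then show ?thesis using False by simp
    next
      case w: False
      then show ?thesis using False G fin(2) by simp
    qed
    ultimately show ?thesis by simp
  qed
  then show "odd (card G)" "odd_lhs Y I G < 1" by auto
qed

text \<open>The tested number is a lower bound for \<open>odd_lhs Y I G\<close>: deviating from
  \<open>heavy Y I\<close> costs at least 0, and if \<open>heavy Y I\<close> is even, the parity of
  \<open>G\<close> forces a deviation at some element, which costs at least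
  \<open>d\<close>.\<close>

lemma summary_complete:
  assumes "summary Y I c q d w" "G \<subseteq> I" "odd (card G)" "odd_lhs Y I G < 1"
  shows "c + (1 - q) * d < 1"
proof -
  let ?S = "\<Sum>l\<in>sym_diff G (heavy Y I). 1 - 2 * mu Y l"
  have fin: "finite I" using assms(1) by (simp add: summary_def)
  have sub: "sym_diff G (heavy Y I) \<subseteq> I"
    using assms(2) by (auto simp: heavy_def)
  have lhs: "odd_lhs Y I G = c + ?S"
    using odd_lhs_eq[OF fin assms(2), of Y] assms(1) by (simp add: summary_def)
  show ?thesis
  proof (cases "odd (card (heavy Y I))")
    case True
    then have "q = 1" using assms(1) by (simp add: summary_def)
    moreover have "?S \<ge> 0" by (intro sum_nonneg mu_half)
    ultimately show ?thesis using lhs assms(4) by simp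
  next
    case False
    then have q: "q = 0" using assms(1) by (simp add: summary_def)
    have "G \<noteq> heavy Y I" using assms(3) False by auto
    then obtain l where l: "l \<in> sym_diff G (heavy Y I)" by auto
    have "d \<le> 1 - 2 * mu Y l"
      using l sub assms(1) by (auto simp: summary_def)
    also have "\<dots> \<le> ?S"
      using fin sub l by (intro member_le_sum mu_half) (auto intro: finite_subset)
    finally show ?thesis using lhs assms(4) q by simp
  qed
qed


section \<open>The separation program\<close>

abbreviation nincr :: "vname \<Rightarrow> com" where
  "nincr x \<equiv> NAssign x (NAdd (NVar x) (NConst 1))"

abbreviation half :: rexp where
  "half \<equiv> RConst (1 / 2)"

text \<open>The array \<open>w\<close> keeps its arbitrary contents: with \<open>d = 1\<close>,
  \<open>summary\<close> puts no condition on it.\<close>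

definition init_body :: com where
  "init_body =
     Seq (RWrite ''c'' (NVar ''i'') (RConst 0))
    (Seq (RWrite ''q'' (NVar ''i'') (RConst 0))
    (Seq (RWrite ''d'' (NVar ''i'') (RConst 1))
         (nincr ''i'')))"

text \<open>The scalar \<open>g\<close> first holds \<open>mu\<close> of the current edge, then its
  toggling cost \<open>1 - 2 * mu\<close>. The argument names an endpoint array, so each edge is
  processed once per endpoint.\<close>

definition update :: "vname \<Rightarrow> com" where
  "update a =
     Seq (NAssign ''u'' (NRead a (NVar ''j'')))
    (Seq (If (RLess half (RRead ''y'' (NVar ''j'')))
           (Seq (RAssign ''g'' (RSub (RConst 1) (RRead ''y'' (NVar ''j''))))
                (RWrite ''q'' (NVar ''u'') (RSub (RConst 1) (RRead ''q'' (NVar ''u'')))))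
           (RAssign ''g'' (RRead ''y'' (NVar ''j''))))
    (Seq (RWrite ''c'' (NVar ''u'') (RAdd (RRead ''c'' (NVar ''u'')) (RVar ''g'')))
    (Seq (RAssign ''g'' (RSub (RConst 1) (RMul (RConst 2) (RVar ''g''))))
         (If (RLess (RVar ''g'') (RRead ''d'' (NVar ''u'')))
           (Seq (RWrite ''d'' (NVar ''u'') (RVar ''g''))
                (NWrite ''w'' (NVar ''u'') (NVar ''j'')))
           Skip))))"

definition scan_body :: com where
  "scan_body = Seq (update ''a'') (Seq (update ''b'') (nincr ''j''))"

text \<open>The search goes on while the lower bound computed at \<open>v\<close> is at least 1.
  There is no test \<open>v < n\<close>: the existence of a violated pair stops the loop.\<close>

definition search_cond :: bexp where
  "search_cond = BNot (RLess
     (RAdd (RRead ''c'' (NVar ''v''))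
       (RMul (RSub (RConst 1) (RRead ''q'' (NVar ''v''))) (RRead ''d'' (NVar ''v''))))
     (RConst 1))"

text \<open>Membership of edge \<open>j\<close> in the set \<open>G\<close> of
  \<open>summary_sound\<close> at the vertex \<open>v\<close>; the exclusive or performs the
  toggling of \<open>w\<close>.\<close>

definition chosen :: bexp where
  "chosen =
     BAnd (bor (nat_eq (NRead ''a'' (NVar ''j'')) (NVar ''v''))
               (nat_eq (NRead ''b'' (NVar ''j'')) (NVar ''v'')))
          (bxor (RLess half (RRead ''y'' (NVar ''j'')))
                (BAnd (RLess (RRead ''q'' (NVar ''v'')) half)
                      (nat_eq (NRead ''w'' (NVar ''v'')) (NVar ''j''))))"

definition output_body :: com where
  "output_body =
     Seq (If chosen (Seq (NWrite ''F'' (NVar ''k'') (NVar ''j'')) (nincr ''k'')) Skip)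
         (nincr ''j'')"

definition init_loop :: com where
  "init_loop = While (NLess (NVar ''i'') (NVar ''n'')) init_body"

definition scan_loop :: com where
  "scan_loop = While (NLess (NVar ''j'') (NVar ''m'')) scan_body"

definition search_loop :: com where
  "search_loop = While search_cond (nincr ''v'')"

definition output_loop :: com where
  "output_loop = While (NLess (NVar ''j'') (NVar ''m'')) output_body"

definition reset :: "vname \<Rightarrow> com" where
  "reset x = NAssign x (NConst 0)"

definition separate :: com where
  "separate =
     Seq (reset ''i'') (Seq init_loop
    (Seq (reset ''j'') (Seq scan_loop
    (Seq (reset ''v'') (Seq search_loop
    (Seq (reset ''j'') (Seq (reset ''k'') output_loop)))))))"

definition n_cost :: nat where
  "n_cost = (1 + bcost (NLess (NVar ''i'') (NVar ''n'')) + max_cost init_body) +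
    (1 + bcost search_cond + max_cost (nincr ''v''))"

definition m_cost :: nat where
  "m_cost = (1 + bcost (NLess (NVar ''j'') (NVar ''m'')) + max_cost scan_body) +
    (1 + bcost (NLess (NVar ''j'') (NVar ''m'')) + max_cost output_body)"

text \<open>Eight sequencing nodes, three loop exits with index tests of equal cost, the exit of the
  search loop, and five resets.\<close>

definition const_cost :: nat where
  "const_cost = 8 + 3 * (1 + bcost (NLess (NVar ''i'') (NVar ''n''))) + (1 + bcost search_cond) +
    5 * max_cost (reset ''i'')"


section \<open>Correctness\<close>

text \<open>The problem on numbered vertices and edges: edge \<open>j\<close> joins
  \<open>A j\<close> and \<open>B j\<close>. Distinct endpoints keep the two updates for an edge
  from counting it twice at one vertex.\<close>

locale separation_input =
  fixes n m :: nat and A B :: "nat \<Rightarrow> nat" and Y :: "nat \<Rightarrow> real"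
  assumes ends: "j < m \<Longrightarrow> A j < n \<and> B j < n \<and> A j \<noteq> B j"
    and Y_bounds: "j < m \<Longrightarrow> 0 \<le> Y j \<and> Y j \<le> 1"
begin

text \<open>Here \<open>j\<close> counts the edges scanned so far, so \<open>inc j\<close> describes
  the progress of the pass and \<open>inc m i\<close> is the set of all edges at
  \<open>i\<close>.\<close>

definition inc :: "nat \<Rightarrow> nat \<Rightarrow> nat set" where
  "inc j i = {l. l < j \<and> (A l = i \<or> B l = i)}"

text \<open>Memory that the program reads but never overwrites, hence preserved through all
  phases.\<close>

definition input :: "state \<Rightarrow> bool" where
  "input s \<longleftrightarrow> nvar s ''n'' = n \<and> nvar s ''m'' = m \<and> narr s ''a'' = A \<and> narr s ''b'' = B \<and>
     rarr s ''y'' = Y"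

definition summaries :: "nat \<Rightarrow> (nat \<Rightarrow> nat set) \<Rightarrow> state \<Rightarrow> bool" where
  "summaries N D s \<longleftrightarrow> (\<forall>i<N.
     summary Y (D i) (rarr s ''c'' i) (rarr s ''q'' i) (rarr s ''d'' i) (narr s ''w'' i))"

lemma within_init_loop:
  assumes "input s" "nvar s ''i'' = 0"
  shows "ends_within init_loop s
    ((1 + bcost (NLess (NVar ''i'') (NVar ''n'')) + max_cost init_body) * n +
     (1 + bcost (NLess (NVar ''i'') (NVar ''n''))))
    (\<lambda>s. input s \<and> summaries n (\<lambda>i. {}) s)"
proof -
  let ?I = "\<lambda>i s. input s \<and> nvar s ''i'' = i \<and> summaries i (\<lambda>i. {}) s"
  have step: "ends_within init_body s (max_cost init_body) (?I (Suc i))" if "?I i s" for i s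
    using that
    by (intro ends_within_loop_free)
      (auto simp: init_body_def input_def summaries_def less_Suc_eq summary_empty)
  show ?thesis unfolding init_loop_def
    by (rule ends_within_mono[OF ends_within_While[where I = ?I]])
      (use assms step in \<open>auto simp: input_def summaries_def\<close>)
qed

text \<open>The family \<open>D\<close> is arbitrary because between the two updates for an edge it
  is neither \<open>inc j\<close> nor \<open>inc (Suc j)\<close>.\<close>

lemma run_update:
  assumes "input s" "summaries n D s" "nvar s ''j'' = j" "narr s a j < n" "j \<notin> D (narr s a j)"
  shows "input (run (update a) s)" "nvar (run (update a) s) ''j'' = j"
    "summaries n (D(narr s a j := insert j (D (narr s a j)))) (run (update a) s)"
proof -
  show "input (run (update a) s)" "nvar (run (update a) s) ''j'' = j"
    using assms by (auto simp: update_def input_def)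
  let ?u = "narr s a j"
  have mu: "mu Y j = (if 1/2 < Y j then 1 - Y j else Y j)"
    by (auto simp: mu_def)
  have "summary Y (D ?u) (rarr s ''c'' ?u) (rarr s ''q'' ?u) (rarr s ''d'' ?u) (narr s ''w'' ?u)"
    using assms by (simp add: summaries_def)
  from summary_insert[OF this assms(5)] assms
  show "summaries n (D(?u := insert j (D ?u))) (run (update a) s)"
    unfolding mu summaries_def
    by (auto simp: update_def input_def of_rat_divide algebra_simps split: if_splits)
qed

lemma within_scan_loop:
  assumes "input s" "summaries n (\<lambda>i. {}) s" "nvar s ''j'' = 0"
  shows "ends_within scan_loop s
    ((1 + bcost (NLess (NVar ''j'') (NVar ''m'')) + max_cost scan_body) * m +
     (1 + bcost (NLess (NVar ''j'') (NVar ''m''))))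
    (\<lambda>s. input s \<and> summaries n (inc m) s)"
proof -
  let ?I = "\<lambda>j s. input s \<and> nvar s ''j'' = j \<and> summaries n (inc j) s"
  have step: "ends_within scan_body s (max_cost scan_body) (?I (Suc j))" if "j < m" "?I j s" for j s
  proof (rule ends_within_loop_free)
    show "loop_free scan_body" by (simp add: scan_body_def update_def)
    let ?s1 = "run (update ''a'') s" and ?s2 = "run (update ''b'') (run (update ''a'') s)"
    let ?D = "(inc j)(A j := insert j (inc j (A j)))"
    have a: "narr s ''a'' = A" using that by (simp add: input_def)
    have 1: "input ?s1" "nvar ?s1 ''j'' = j" "summaries n ?D ?s1"
      using run_update[of s "inc j" j "''a''"] that ends[OF that(1)]
      by (auto simp: a inc_def)
    have b: "narr ?s1 ''b'' = B" using 1 by (simp add: input_def)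
    \<comment> \<open>Since \<open>A j\<close> and \<open>B j\<close> differ, the first update has
      not put \<open>j\<close> into \<open>?D (B j)\<close>, so the second one counts it there for
      the first time.\<close>
    have 2: "input ?s2" "nvar ?s2 ''j'' = j"
      "summaries n (?D(B j := insert j (?D (B j)))) ?s2"
      using run_update[of ?s1 ?D j "''b''"] 1 ends[OF that(1)]
      by (auto simp: b inc_def)
    have "?D(B j := insert j (?D (B j))) = inc (Suc j)"
      using ends[OF that(1)] by (auto simp: inc_def fun_eq_iff less_Suc_eq)
    from 2[unfolded this] show "?I (Suc j) (run scan_body s)"
      by (simp add: scan_body_def input_def summaries_def)
  qed
  have "inc 0 = (\<lambda>i. {})" by (simp add: inc_def fun_eq_iff)
  with assms show ?thesis unfolding scan_loop_def
    by (intro ends_within_mono[OF ends_within_While[where I = ?I]])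
      (use step in \<open>auto simp: input_def\<close>)
qed

definition violated :: "nat \<Rightarrow> nat set \<Rightarrow> bool" where
  "violated i G \<longleftrightarrow> i < n \<and> G \<subseteq> inc m i \<and> odd (card G) \<and> odd_lhs Y (inc m i) G < 1"

text \<open>By \<open>summary_complete\<close> the vertex \<open>i0\<close> passes the test, so the
  loop stops after exactly \<open>i1\<close> iterations, where \<open>i1\<close> is the least number
  passing it and hence below \<open>n\<close>.\<close>

lemma within_search_loop:
  assumes "input s" "summaries n (inc m) s" "nvar s ''v'' = 0" "violated i0 G0"
  shows "ends_within search_loop s
    ((1 + bcost search_cond + max_cost (nincr ''v'')) * n + (1 + bcost search_cond))
    (\<lambda>s. input s \<and> summaries n (inc m) s \<and> nvar s ''v'' < n \<and> \<not> bval search_cond s)"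
proof -
  let ?test = "\<lambda>i. rarr s ''c'' i + (1 - rarr s ''q'' i) * rarr s ''d'' i < 1"
  define i1 where "i1 = (LEAST i. ?test i)"
  have "i0 < n" and G0: "G0 \<subseteq> inc m i0" "odd (card G0)" "odd_lhs Y (inc m i0) G0 < 1"
    using assms(4) by (auto simp: violated_def)
  then have i0: "?test i0" "i0 < n"
    using assms(2) by (auto intro!: summary_complete[OF _ G0] simp: summaries_def)
  have i1: "?test i1" "i1 < n"
    using LeastI[of ?test, OF i0(1)] Least_le[of ?test, OF i0(1)] i0(2) by (auto simp: i1_def)
  have less: "\<not> ?test i" if "i < i1" for i
    using not_less_Least[of i ?test] that by (simp add: i1_def)
  \<comment> \<open>Fixing the whole state up to \<open>v\<close> makes every test refer to the same
    summaries.\<close>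
  let ?I = "\<lambda>i s'. s' = s\<lparr>nvar := (nvar s)(''v'' := i)\<rparr>"
  have step: "ends_within (nincr ''v'') s' (max_cost (nincr ''v'')) (?I (Suc i))" if "?I i s'" for i s'
    using that by (intro ends_within_loop_free) auto
  have "ends_within search_loop s
    ((1 + bcost search_cond + max_cost (nincr ''v'')) * i1 + (1 + bcost search_cond)) (?I i1)"
    unfolding search_loop_def
  proof (rule ends_within_While[where I = ?I])
    show "bval search_cond s' \<and> ends_within (nincr ''v'') s' (max_cost (nincr ''v'')) (?I (Suc i))"
      if "i < i1" "?I i s'" for i s'
      using step[OF that(2)] less[OF that(1)] that(2) by (simp add: search_cond_def)
    show "\<not> bval search_cond s'" if "?I i1 s'" for s'
      using that i1(1) by (simp add: search_cond_def)
    show "?I 0 s" using assms(3) by (simp add: fun_upd_idem)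
  qed
  then obtain k s' where k: "exec search_loop s k s'" "?I i1 s'"
    "k \<le> (1 + bcost search_cond + max_cost (nincr ''v'')) * i1 + (1 + bcost search_cond)"
    unfolding ends_within_def by blast
  note k(3)
  also have "\<dots> \<le> (1 + bcost search_cond + max_cost (nincr ''v'')) * n + (1 + bcost search_cond)"
    using i1(2) by (intro add_right_mono mult_left_mono) auto
  finally show ?thesis
    using k(1,2) assms(1,2) i1 unfolding ends_within_def
    by (intro exI[of _ k] exI[of _ s']) (auto simp: input_def summaries_def search_cond_def)
qed

lemma within_output_loop:
  assumes "input s" "summaries n (inc m) s" "nvar s ''v'' < n" "\<not> bval search_cond s"
    "nvar s ''j'' = 0" "nvar s ''k'' = 0"
  shows "ends_within output_loop s
    ((1 + bcost (NLess (NVar ''j'') (NVar ''m'')) + max_cost output_body) * m +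
     (1 + bcost (NLess (NVar ''j'') (NVar ''m''))))
    (\<lambda>s. violated (nvar s ''v'') (narr s ''F'' ` {..<nvar s ''k''}))"
proof -
  define v where "v = nvar s ''v''"
  define q where "q = rarr s ''q'' v"
  define w where "w = narr s ''w'' v"
  \<comment> \<open>The part of the set from \<open>summary_sound\<close> found among the first
    \<open>j\<close> edges; \<open>?G m\<close> is that set itself.\<close>
  let ?G = "\<lambda>j. {l \<in> inc j v. (Y l > 1/2) \<noteq> (q < 1/2 \<and> w = l)}"
  let ?I = "\<lambda>j s. input s \<and> nvar s ''j'' = j \<and> nvar s ''v'' = v \<and> rarr s ''q'' v = q \<and>
    narr s ''w'' v = w \<and> narr s ''F'' ` {..<nvar s ''k''} = ?G j"
  have step: "ends_within output_body s (max_cost output_body) (?I (Suc j))" if I: "?I j s" for j s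
  proof (rule ends_within_loop_free)
    show "loop_free output_body" by (simp add: output_body_def)
    have ch: "bval chosen s \<longleftrightarrow> (A j = v \<or> B j = v) \<and> ((Y j > 1/2) \<noteq> (q < 1/2 \<and> w = j))"
      using I by (simp add: chosen_def input_def of_rat_divide)
    have G: "?G (Suc j) = (if bval chosen s then insert j (?G j) else ?G j)"
      unfolding ch by (auto simp: inc_def less_Suc_eq)
    show "?I (Suc j) (run output_body s)"
    proof (cases "bval chosen s")
      case True
      \<comment> \<open>Simplifying the image under the updated array leaves the old indices that
        differ from the written cell \<open>k\<close>, which are all of them.\<close>
      have "{..<nvar s ''k''} \<inter> {x. x \<noteq> nvar s ''k''} = {..<nvar s ''k''}"
        by auto
      then show ?thesis
        using I True unfolding G by (simp add: output_body_def input_def lessThan_Suc)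
    next
      case False
      then show ?thesis
        using I unfolding G by (simp add: output_body_def input_def)
    qed
  qed
  have sum: "summary Y (inc m v) (rarr s ''c'' v) q (rarr s ''d'' v) w"
    using assms(2,3) by (simp add: summaries_def v_def q_def w_def)
  have "rarr s ''c'' v + (1 - q) * rarr s ''d'' v < 1"
    using assms(4) by (simp add: search_cond_def v_def q_def)
  from summary_sound[OF sum this] Y_bounds
  have "violated v (?G m)"
    using assms(3) by (auto simp: violated_def v_def inc_def)
  moreover have "?I 0 s"
    using assms by (auto simp: v_def q_def w_def inc_def)
  ultimately show ?thesis unfolding output_loop_def
    by (intro ends_within_mono[OF ends_within_While[where I = ?I and N = m]])
      (use step in \<open>auto simp: input_def\<close>)
qed

lemma reset_keeps [simp]:
  "x \<notin> {''n'', ''m''} \<Longrightarrow> input (run (reset x) s) = input s"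
  "summaries N D (run (reset x) s) = summaries N D s"
  "x \<noteq> ''v'' \<Longrightarrow> bval search_cond (run (reset x) s) = bval search_cond s"
  "nvar (run (reset x) s) x' = (if x' = x then 0 else nvar s x')"
  by (auto simp: reset_def input_def summaries_def search_cond_def)

text \<open>The phases are assembled from last to first, so that each suffix of the program starts
  from the postcondition of the phase before it. The violated pair enters through the search
  loop.\<close>

lemma within_separate:
  assumes "input s" "violated i0 G0"
  shows "ends_within separate s (const_cost + n_cost * n + m_cost * m)
    (\<lambda>s. violated (nvar s ''v'') (narr s ''F'' ` {..<nvar s ''k''}))"
proof -
  let ?b = "1 + bcost (NLess (NVar ''i'') (NVar ''n''))"
  let ?r = "max_cost (reset ''i'')"
  let ?Q = "\<lambda>s. violated (nvar s ''v'') (narr s ''F'' ` {..<nvar s ''k''})"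
  have r: "ends_within (reset x) s ?r (\<lambda>s'. s' = run (reset x) s)" for x s
    using ends_within_loop_free[of "reset x"] by (simp add: reset_def)
  have b: "bcost (NLess (NVar ''j'') (NVar ''m'')) = bcost (NLess (NVar ''i'') (NVar ''n''))"
    by simp
  let ?c4 = "Seq (reset ''j'') (Seq (reset ''k'') output_loop)"
  let ?t4 = "1 + ?r + (1 + ?r + ((?b + max_cost output_body) * m + ?b))"
  have 4: "ends_within ?c4 s ?t4 ?Q"
    if "input s \<and> summaries n (inc m) s \<and> nvar s ''v'' < n \<and> \<not> bval search_cond s" for s
    by (rule ends_within_Seq[OF r], rule ends_within_Seq[OF r],
        rule within_output_loop[unfolded b]) (use that in simp_all)
  let ?c3 = "Seq (reset ''v'') (Seq search_loop ?c4)"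
  let ?t3 = "1 + ?r +
    (1 + ((1 + bcost search_cond + max_cost (nincr ''v'')) * n + (1 + bcost search_cond)) + ?t4)"
  have 3: "ends_within ?c3 s ?t3 ?Q" if "input s \<and> summaries n (inc m) s" for s
    by (rule ends_within_Seq[OF r],
        rule ends_within_Seq[OF within_search_loop[OF _ _ _ assms(2)] 4])
      (use that in simp_all)
  let ?c2 = "Seq (reset ''j'') (Seq scan_loop ?c3)"
  let ?t2 = "1 + ?r + (1 + ((?b + max_cost scan_body) * m + ?b) + ?t3)"
  have 2: "ends_within ?c2 s ?t2 ?Q" if "input s \<and> summaries n (\<lambda>i. {}) s" for s
    by (rule ends_within_Seq[OF r], rule ends_within_Seq[OF within_scan_loop[unfolded b] 3])
      (use that in simp_all)
  have "ends_within separate s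
    (1 + ?r + (1 + ((?b + max_cost init_body) * n + ?b) + ?t2)) ?Q"
    unfolding separate_def
    by (rule ends_within_Seq[OF r], rule ends_within_Seq[OF within_init_loop 2])
      (use assms(1) in simp_all)
  moreover have "1 + ?r + (1 + ((?b + max_cost init_body) * n + ?b) + ?t2) =
    const_cost + n_cost * n + m_cost * m"
    unfolding const_cost_def n_cost_def m_cost_def b by (simp only: algebra_simps)
  ultimately show ?thesis by simp
qed

end

section \<open>Transfer from indices to the graph\<close>

lemma card_edges_le:
  assumes "simple_graph V E"
  shows "card E \<le> card V * card V"
proof -
  have fin: "finite V" using assms by (simp add: simple_graph_def)
  have "E \<subseteq> (\<lambda>(a, b). {a, b}) ` (V \<times> V)"
  proof
    fix e assume "e \<in> E"
    with assms obtain a b where "e = {a, b}" "a \<in> V" "b \<in> V"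
      unfolding simple_graph_def by (metis card_2_iff insert_subset)
    then show "e \<in> (\<lambda>(a, b). {a, b}) ` (V \<times> V)" by force
  qed
  with fin have "card E \<le> card (V \<times> V)"
    by (meson finite_SigmaI surj_card_le)
  then show ?thesis by (simp add: card_cartesian_product)
qed

theorem theorem2:
  "\<exists>(prog :: com) (T :: nat \<Rightarrow> nat).
     (\<lambda>n. real (T n)) \<in> O(\<lambda>n. (real n)\<^sup>2) \<and>
     (\<forall>(V :: nat set) (E :: nat set set) x y z t vs es s.
        simple_graph V E \<longrightarrow>
        relaxed_solution V E x y z t \<longrightarrow>
        (\<exists>v F. violated_pair V E y v F) \<longrightarrow>
        encodes_input V E x y z t vs es s \<longrightarrow>
        (\<exists>k s' v F. exec prog s k s' \<and> k \<le> T (card V) \<and>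
           encodes_output vs es s' v F \<and> violated_pair V E y v F))"
proof (rule exI[of _ separate],
    rule exI[of _ "\<lambda>n. const_cost + n_cost * n + m_cost * (n * n)"], intro conjI allI impI)
  let ?T = "\<lambda>n. const_cost + n_cost * n + m_cost * (n * n)"
  show "(\<lambda>n. real (?T n)) \<in> O(\<lambda>n. (real n)\<^sup>2)"
  proof (rule bigoI)
    show "\<forall>\<^sub>F n in sequentially. norm (real (?T n)) \<le> real (const_cost + n_cost + m_cost) * norm ((real n)\<^sup>2)"
      \<comment> \<open>For \<open>n\<close> at least 1 the constant and the linear term are
        absorbed by \<open>n * n\<close>.\<close>
      using eventually_ge_at_top[of 1]
    proof eventually_elim
      case (elim n)
      then have "const_cost \<le> const_cost * (n * n)" "n_cost * n \<le> n_cost * (n * n)"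
        by simp_all
      then have "?T n \<le> (const_cost + n_cost + m_cost) * (n * n)"
        unfolding add_mult_distrib by linarith
      then have "real (?T n) \<le> real ((const_cost + n_cost + m_cost) * (n * n))"
        by (rule of_nat_mono)
      then show ?case by (simp add: power2_eq_square)
    qed
  qed
  fix V :: "nat set" and E :: "nat set set" and x y z t :: "nat set \<Rightarrow> real"
    and vs :: "nat list" and es :: "nat set list" and s
  assume graph: "simple_graph V E" and sol: "relaxed_solution V E x y z t"
    and ex: "\<exists>v F. violated_pair V E y v F" and enc: "encodes_input V E x y z t vs es s"
  define n m where nm_def: "n = length vs" "m = length es"
  define A B where AB_def: "A = narr s ''a''" "B = narr s ''b''"
  define Y where "Y = rarr s ''y''"
  note defs = nm_def AB_def Y_def
  have vs: "distinct vs" "set vs = V" and es: "distinct es" "set es = E"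
    and endpoints: "\<And>j. j < m \<Longrightarrow> A j < n \<and> B j < n \<and> es ! j = {vs ! A j, vs ! B j}"
    and Y: "\<And>j. j < m \<Longrightarrow> Y j = y (es ! j)"
    and nm: "nvar s ''n'' = n" "nvar s ''m'' = m"
    using enc by (auto simp: encodes_input_def defs)
  have edge: "es ! j \<in> E" if "j < m" for j
    using that es by (auto simp: defs)
  interpret separation_input n m A B Y
  proof
    fix j assume j: "j < m"
    have "card (es ! j) = 2"
      using edge[OF j] graph by (simp add: simple_graph_def)
    then show "A j < n \<and> B j < n \<and> A j \<noteq> B j"
      using endpoints[OF j] by auto
    show "0 \<le> Y j \<and> Y j \<le> 1"
      using Y[OF j] edge[OF j] sol by (simp add: relaxed_solution_def)
  qed
  \<comment> \<open>Distinctness of \<open>vs\<close> turns membership of a vertex in an edge into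
    equality of indices.\<close>
  have incident: "incident E (vs ! i) = (!) es ` inc m i" if "i < n" for i
  proof -
    have "vs ! i \<in> es ! j \<longleftrightarrow> A j = i \<or> B j = i" if "j < m" for j
      using endpoints[OF that] vs(1) \<open>i < n\<close> by (auto simp: defs nth_eq_iff_index_eq)
    moreover have "E = (!) es ` {..<m}"
      using es(2) by (auto simp: defs set_conv_nth)
    ultimately show ?thesis by (auto simp: incident_def inc_def)
  qed
  have inj: "inj_on ((!) es) I" if "I \<subseteq> {..<m}" for I
    using that es(1) by (intro inj_on_nth) (auto simp: defs)
  \<comment> \<open>Positions in \<open>es\<close> correspond one to one to edges, so cardinalities
    and sums carry over. The equivalence is used in both directions: for the assumed violated pair
    and for the output.\<close>
  have violated_iff: "violated_pair V E y (vs ! i) ((!) es ` G) \<longleftrightarrow> violated i G"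
    if "i < n" "G \<subseteq> inc m i" for i G
  proof -
    have sub: "inc m i \<subseteq> {..<m}" by (auto simp: inc_def)
    have "(!) es ` inc m i - (!) es ` G = (!) es ` (inc m i - G)"
      using inj[OF sub] that(2) by (simp add: inj_on_image_set_diff)
    moreover have "inj_on ((!) es) G" "inj_on ((!) es) (inc m i - G)"
      using that(2) sub by (auto intro!: inj)
    moreover have "(\<Sum>l\<in>G. 1 - y (es ! l)) = (\<Sum>l\<in>G. 1 - Y l)"
      "(\<Sum>l\<in>inc m i - G. y (es ! l)) = (\<Sum>l\<in>inc m i - G. Y l)"
      using that(2) sub by (auto intro!: sum.cong simp: Y subset_iff)
    moreover have "vs ! i \<in> V" using that(1) vs(2) by (auto simp: defs)
    ultimately show ?thesis
      using that by (auto simp: violated_pair_def odd_set_constraint_def violated_def odd_lhs_def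
          incident sum.reindex card_image)
  qed
  obtain v F where vF: "violated_pair V E y v F" using ex by blast
  then obtain i where i: "i < n" "v = vs ! i"
    using vs(2) by (auto simp: violated_pair_def defs in_set_conv_nth)
  then obtain G where G: "G \<subseteq> inc m i" "F = (!) es ` G"
    using vF incident by (metis subset_image_iff violated_pair_def)
  have "violated i G" using vF i G violated_iff by blast
  moreover have "input s" unfolding input_def using nm by (simp add: AB_def Y_def)
  ultimately obtain k s' where k: "exec separate s k s'" "k \<le> const_cost + n_cost * n + m_cost * m"
    and out: "violated (nvar s' ''v'') (narr s' ''F'' ` {..<nvar s' ''k''})"
    using within_separate unfolding ends_within_def by blast
  let ?v = "nvar s' ''v''" and ?G = "narr s' ''F'' ` {..<nvar s' ''k''}"
  have v: "?v < n" "?G \<subseteq> inc m ?v" using out by (auto simp: violated_def)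
  have "n = card V" "m = card E"
    using vs es by (auto simp: defs distinct_card)
  with k(2) have "k \<le> const_cost + n_cost * card V + m_cost * card E" by simp
  \<comment> \<open>The square bound on the number of edges makes the time, linear in vertices plus
    edges, quadratic in the vertices.\<close>
  then have "k \<le> ?T (card V)"
    using mult_le_mono2[OF card_edges_le[OF graph], of m_cost] by linarith
  moreover have "narr s' ''F'' i < m" if "i < nvar s' ''k''" for i
    using that v(2) by (auto simp: inc_def)
  then have "encodes_output vs es s' (vs ! ?v) ((!) es ` ?G)"
    using v(1) by (auto simp: encodes_output_def defs)
  moreover have "violated_pair V E y (vs ! ?v) ((!) es ` ?G)"
    using violated_iff[OF v] out by simp
  ultimately show "\<exists>k s' v F. exec separate s k s' \<and> k \<le> ?T (card V) \<and>
      encodes_output vs es s' v F \<and> violated_pair V E y v F"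
    using k(1) by blast
qed

end
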